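(* Let $q\in(0,1)$. Let $\{A_n\}_{n\ge 1}$ be a sequence of real numbers with $A_1=1$, and put $B_n=\dfrac{A_n(1-q^n)}{1-q}$ for all $n\ge 1$. Suppose that either $$1\ge B_2\ge B_3\ge\cdots\ge B_n\ge\cdots\ge 0$$ or $$1\le B_2\le B_3\le\cdots\le B_n\le\cdots\le 2 .$$ Then $f(z)=z+\sum_{n=2}^\infty A_nz^n$ belongs to $\mathcal{K}_q$ with the function $g(z)=z/(1-z)$.
   Context: $\mathbb{D}=\{z\in\mathbb{C}:|z|<1\}$. $\mathcal{A}$ is the class of functions $f$ analytic in $\mathbb{D}$ with $f(0)=0=f'(0)-1$. $\mathcal{S}^*\subset\mathcal{A}$ is the class of univalent functions $g\in\mathcal{A}$ that are starlike with respect to the origin ($tw\in g(\mathbb{D})$ whenever $t\in[0,1]$, $w\in g(\mathbb{D})$). For $q\in(0,1)$ and $f\in\mathcal{A}$, the $q$-difference operator is $(D_qf)(z)=\dfrac{f(z)-f(qz)}{z(1-q)}$ for $z\in\mathbb{D}\setminus\{0\}$, and $(D_qf)(0)=f'(0)$. A function $f\in\mathcal{A}$ belongs to $\mathcal{K}_q$ ($q$-close-to-convex functions) if there exists $g\in\mathcal{S}^*$ such that $$\left|\frac{z}{g(z)}(D_qf)(z)-\frac{1}{1-q}\right|\le\frac{1}{1-q},\quad z\in\mathbb{D}$$ (where $z/g(z)$ is given its limit value $1$ at $z=0$); one then says that $f\in\mathcal{K}_q$ with the function $g$. *)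

theory Defs
  imports "HOL-Analysis.Analysis"
begin

text \<open>The classes below are sets of total functions; only their values on the
  open unit disc matter.\<close>

abbreviation unit_disc :: "complex set"
  where "unit_disc \<equiv> ball 0 1"

definition class_A :: "(complex \<Rightarrow> complex) set"
  where "class_A = {f. f analytic_on unit_disc \<and> f 0 = 0 \<and> deriv f 0 = 1}"

definition class_S_star :: "(complex \<Rightarrow> complex) set"
  where "class_S_star = {g \<in> class_A. inj_on g unit_disc \<and>
    (\<forall>t\<in>{0..1}. \<forall>w\<in>g ` unit_disc. complex_of_real t * w \<in> g ` unit_disc)}"

definition q_diff :: "real \<Rightarrow> (complex \<Rightarrow> complex) \<Rightarrow> complex \<Rightarrow> complex"
  where "q_diff q f z =
    (if z = 0 then deriv f 0
     else (f z - f (complex_of_real q * z)) / (z * (1 - complex_of_real q)))"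

text \<open>The inner conditional gives \<open>z / g z\<close> its limit value \<open>1\<close> at \<open>0\<close>.
  For \<open>z \<noteq> 0\<close> in the disc no division by zero occurs, because \<open>g\<close> is injective
  there with \<open>g 0 = 0\<close>.\<close>

definition q_close_to_convex_with ::
    "real \<Rightarrow> (complex \<Rightarrow> complex) \<Rightarrow> (complex \<Rightarrow> complex) \<Rightarrow> bool"
  where "q_close_to_convex_with q f g \<longleftrightarrow>
    f \<in> class_A \<and> g \<in> class_S_star \<and>
    (\<forall>z\<in>unit_disc.
      cmod ((if z = 0 then 1 else z / g z) * q_diff q f z - complex_of_real (1 / (1 - q)))
        \<le> 1 / (1 - q))"

definition class_K :: "real \<Rightarrow> (complex \<Rightarrow> complex) set"
  where "class_K q = {f. \<exists>g. q_close_to_convex_with q f g}"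

end

theory Submission
  imports Defs
begin

text \<open>
  On the disc the operator \<open>q_diff q\<close> acts on Taylor coefficients: it turns
  \<open>\<Sum>n. A n * z ^ n\<close> into \<open>\<Sum>n. B (n + 1) * z ^ n\<close>. For \<open>g z = z / (1 - z)\<close> the factor
  \<open>z / g z\<close> is \<open>1 - z\<close>, and multiplying a power series by \<open>1 - z\<close> replaces its coefficients
  by their consecutive differences (\<open>one_minus_times_powser\<close>). Hence
  \<open>z / g z * q_diff q f z = 1 + (\<Sum>n. (B (n + 2) - B (n + 1)) * z ^ (n + 1))\<close>.

  As \<open>B\<close> is monotone and stays within distance \<open>1\<close> of \<open>B 1 = 1\<close>, its total variation is at
  most \<open>1\<close>, so the series on the right has modulus at most \<open>1\<close> on the disc
  (\<open>norm_powser_le_of_sum_norm_le\<close>). The distance of \<open>z / g z * q_diff q f z\<close> from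
  \<open>1 / (1 - q)\<close> is therefore at most \<open>(1 / (1 - q) - 1) + 1 = 1 / (1 - q)\<close>.

  The same factor \<open>(1 - q ^ n) / (1 - q)\<close> that produces \<open>B n\<close> is at least \<open>1\<close>, so
  \<open>\<bar>A n\<bar> \<le> \<bar>B n\<bar> \<le> 2\<close>; bounded coefficients make the series of \<open>f\<close> converge on the disc and
  put \<open>f\<close> in \<open>class_A\<close>.

  The function \<open>z / (1 - z)\<close> is starlike because it maps the disc onto the half-plane
  \<open>Re w > - 1 / 2\<close>, which is convex and contains \<open>0\<close>.
\<close>

section \<open>Power series on the disc and the q-difference operator\<close>

lemma summable_powser_bounded_coeffs:
  fixes c :: "nat \<Rightarrow> complex"
  assumes "\<And>n. norm (c n) \<le> M" and "norm z < 1"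
  shows "summable (\<lambda>n. c n * z ^ n)"
proof (rule summable_comparison_test')
  show "summable (\<lambda>n. M * norm z ^ n)"
    using assms(2) by (intro summable_mult summable_geometric) simp
  show "norm (c n * z ^ n) \<le> M * norm z ^ n" if "n \<ge> 0" for n
    using assms(1)[of n] by (simp add: norm_mult norm_power mult_right_mono)
qed

lemma powser_in_class_A:
  assumes summable: "\<And>z. norm z < 1 \<Longrightarrow> summable (\<lambda>n. c n * z ^ n)"
    and f: "\<And>z. norm z < 1 \<Longrightarrow> f z = (\<Sum>n. c n * z ^ n)"
    and "c 0 = 0" "c 1 = 1"
  shows "f \<in> class_A"
proof -
  have deriv: "(f has_field_derivative (\<Sum>n. diffs c n * z ^ n)) (at z)" if "norm z < 1" for z
  proof (rule has_field_derivative_transform_within_open)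
    show "((\<lambda>z. \<Sum>n. c n * z ^ n) has_field_derivative (\<Sum>n. diffs c n * z ^ n)) (at z)"
      using termdiffs_strong'[of 1 c z] summable that by simp
  qed (use that f in \<open>auto intro!: open_ball[of 0 1]\<close>)
  have "f holomorphic_on unit_disc"
    using deriv by (auto simp: holomorphic_on_open intro!: exI)
  moreover have "f 0 = 0"
    using f[of 0] \<open>c 0 = 0\<close> by (simp add: powser_zero)
  moreover have "deriv f 0 = 1"
    using DERIV_imp_deriv[OF deriv[of 0]] \<open>c 1 = 1\<close> by (simp add: powser_zero diffs_def)
  ultimately show ?thesis
    by (simp add: class_A_def analytic_on_open)
qed

lemma q_diff_powser:
  assumes q: "0 < q" "q < 1"
    and summable: "\<And>z. norm z < 1 \<Longrightarrow> summable (\<lambda>n. c n * z ^ n)"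
    and f: "\<And>z. norm z < 1 \<Longrightarrow> f z = (\<Sum>n. c n * z ^ n)"
    and z: "norm z < 1" "z \<noteq> 0"
  shows "(\<lambda>n. c (Suc n) * of_real ((1 - q ^ Suc n) / (1 - q)) * z ^ n) sums q_diff q f z"
proof -
  have qz: "norm (of_real q * z) < 1"
    using q z(1) mult_strict_mono[of q 1 "norm z" 1] by (simp add: norm_mult)
  have "(\<lambda>n. c n * z ^ n - c n * (of_real q * z) ^ n) sums (f z - f (of_real q * z))"
    using z(1) qz summable f by (intro sums_diff) (auto intro: summable_sums)
  \<comment> \<open>The constant terms cancel, so dividing by \<open>z\<close> only shifts the series.\<close>
  then have "(\<lambda>n. c (Suc n) * z ^ Suc n - c (Suc n) * (of_real q * z) ^ Suc n)
      sums (f z - f (of_real q * z))"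
    by (subst sums_Suc_iff) simp
  then have "(\<lambda>n. (c (Suc n) * z ^ Suc n - c (Suc n) * (of_real q * z) ^ Suc n) /
      (z * (1 - of_real q))) sums q_diff q f z"
    using z(2) by (simp add: q_diff_def sums_divide)
  moreover have "(c (Suc n) * z ^ Suc n - c (Suc n) * (of_real q * z) ^ Suc n) /
      (z * (1 - of_real q)) = c (Suc n) * of_real ((1 - q ^ Suc n) / (1 - q)) * z ^ n" for n
  proof -
    have "1 - complex_of_real q \<noteq> 0"
      using q by (metis less_irrefl of_real_1 of_real_eq_iff right_minus_eq)
    then show ?thesis
      using z(2) by (simp add: field_simps power_mult_distrib)
  qed
  ultimately show ?thesis by simp
qed

section \<open>Coefficients of bounded variation\<close>

lemma one_minus_times_powser:
  fixes z :: complex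
  assumes "(\<lambda>n. b n * z ^ n) sums s"
  shows "(\<lambda>n. (b (Suc n) - b n) * z ^ Suc n) sums ((1 - z) * s - b 0)"
proof -
  have "(\<lambda>n. b (Suc n) * z ^ Suc n) sums (s - b 0)"
    using assms sums_Suc_iff[of "\<lambda>n. b n * z ^ n" "s - b 0"] by simp
  from sums_diff[OF this sums_mult[OF assms, of z]] show ?thesis
    by (simp add: algebra_simps)
qed

lemma norm_powser_le_of_sum_norm_le:
  fixes z :: complex
  assumes "(\<lambda>n. d n * z ^ Suc n) sums s" and "norm z < 1"
    and V: "\<And>N. (\<Sum>n<N. norm (d n)) \<le> V"
  shows "norm s \<le> V"
proof (rule Lim_bounded)
  show "(\<lambda>N. norm (\<Sum>n<N. d n * z ^ Suc n)) \<longlonglongrightarrow> norm s"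
    using assms(1) by (intro tendsto_norm) (simp add: sums_def)
  have "norm (\<Sum>n<N. d n * z ^ Suc n) \<le> V" for N
  proof -
    have "norm (\<Sum>n<N. d n * z ^ Suc n) \<le> (\<Sum>n<N. norm (d n))"
    proof (rule sum_norm_le)
      fix n
      have "norm z ^ Suc n \<le> 1"
        using assms(2) by (intro power_le_one) auto
      then show "norm (d n * z ^ Suc n) \<le> norm (d n)"
        by (simp only: norm_mult norm_power mult_left_le norm_ge_zero)
    qed
    then show ?thesis using V[of N] by simp
  qed
  then show "\<forall>N\<ge>0. norm (\<Sum>n<N. d n * z ^ Suc n) \<le> V" by simp
qed

lemma sum_abs_diff_monotone:
  fixes b :: "nat \<Rightarrow> real"
  assumes "(\<forall>n. b (Suc n) \<le> b n) \<or> (\<forall>n. b n \<le> b (Suc n))"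
  shows "(\<Sum>n<N. \<bar>b (Suc n) - b n\<bar>) = \<bar>b N - b 0\<bar>"
  using assms
proof
  assume dec: "\<forall>n. b (Suc n) \<le> b n"
  then have "b N \<le> b 0"
    using lift_Suc_antimono_le[of b 0 N] by simp
  moreover have "\<bar>b (Suc n) - b n\<bar> = b n - b (Suc n)" for n
    using dec by (simp add: abs_of_nonpos)
  ultimately show ?thesis
    using sum_lessThan_telescope'[of b N] by simp
next
  assume inc: "\<forall>n. b n \<le> b (Suc n)"
  then have "b 0 \<le> b N"
    using lift_Suc_mono_le[of b 0 N] by simp
  with inc show ?thesis
    using sum_lessThan_telescope[of b N] by simp
qed

section \<open>Starlikeness of the half-plane map\<close>

text \<open>
  With \<open>w = z / (1 - z)\<close>, that is \<open>z = w / (1 + w)\<close>, the condition \<open>norm z < 1\<close> says that \<open>w\<close>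
  is nearer to \<open>0\<close> than to \<open>- 1\<close>.
\<close>

lemma half_plane_map_image: "(\<lambda>z. z / (1 - z)) ` unit_disc = {w. Re w > - 1 / 2}"
proof -
  have nearer: "norm w < norm (1 + w) \<longleftrightarrow> Re w > - 1 / 2" for w :: complex
    by (auto simp: cmod_def power2_eq_square algebra_simps)
  show ?thesis
  proof (intro equalityI subsetI)
    fix w assume "w \<in> (\<lambda>z. z / (1 - z)) ` unit_disc"
    then obtain z where z: "norm z < 1" and w: "w = z / (1 - z)" by auto
    have "z \<noteq> 1" using z by auto
    then have "1 + w = 1 / (1 - z)" by (simp add: w field_simps)
    then have "norm w < norm (1 + w)"
      using z \<open>z \<noteq> 1\<close> by (simp add: w norm_divide divide_strict_right_mono)
    then show "w \<in> {w. Re w > - 1 / 2}" by (simp add: nearer)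
  next
    fix w :: complex assume w: "w \<in> {w. Re w > - 1 / 2}"
    then have less: "norm w < norm (1 + w)" by (simp add: nearer)
    then have nz: "1 + w \<noteq> 0" by auto
    then have "1 - w / (1 + w) = 1 / (1 + w)" by (simp add: field_simps)
    then have "w = (w / (1 + w)) / (1 - w / (1 + w))" using nz by simp
    moreover have "w / (1 + w) \<in> unit_disc"
      using less nz by (simp add: norm_divide divide_less_eq_1)
    ultimately show "w \<in> (\<lambda>z. z / (1 - z)) ` unit_disc" by (rule image_eqI)
  qed
qed

lemma half_plane_map_in_class_S_star: "(\<lambda>z. z / (1 - z)) \<in> class_S_star"
proof -
  let ?g = "\<lambda>z :: complex. z / (1 - z)"
  have ne1: "z \<noteq> 1" if "norm z < 1" for z :: complex using that by auto
  have "?g \<in> class_A"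
  proof -
    have "?g holomorphic_on unit_disc"
      using ne1 by (intro holomorphic_intros) auto
    moreover have "(?g has_field_derivative 1) (at 0)"
      by (auto intro!: derivative_eq_intros)
    ultimately show ?thesis
      by (simp add: class_A_def analytic_on_open DERIV_imp_deriv)
  qed
  moreover have "inj_on ?g unit_disc"
    using ne1 by (auto simp: inj_on_def field_simps)
  moreover have "of_real t * w \<in> ?g ` unit_disc" if "t \<in> {0..1}" "w \<in> ?g ` unit_disc" for t w
  proof -
    have t: "0 \<le> t" "t \<le> 1" and w: "Re w > - 1 / 2"
      using that by (auto simp: half_plane_map_image)
    have "t * Re w > - 1 / 2"
    proof (cases "Re w \<ge> 0")
      case True
      then have "t * Re w \<ge> 0" using t by simp
      then show ?thesis by simp
    next
      case False
      then have "t * Re w \<ge> 1 * Re w" using t by (intro mult_right_mono_neg) auto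
      then show ?thesis using w by simp
    qed
    then show ?thesis by (simp add: half_plane_map_image)
  qed
  ultimately show ?thesis unfolding class_S_star_def by blast
qed

section \<open>The coefficient criterion for q-close-to-convexity\<close>

theorem theorem2p2:
  fixes q :: real and A B :: "nat \<Rightarrow> real" and f :: "complex \<Rightarrow> complex"
  assumes "0 < q" and "q < 1"
    and "A 1 = 1"
    and "\<And>n. n \<ge> 1 \<Longrightarrow> B n = A n * (1 - q ^ n) / (1 - q)"
    and "(1 \<ge> B 2 \<and> (\<forall>n\<ge>2. B n \<ge> B (Suc n)) \<and> (\<forall>n\<ge>2. B n \<ge> 0)) \<or>
         (1 \<le> B 2 \<and> (\<forall>n\<ge>2. B n \<le> B (Suc n)) \<and> (\<forall>n\<ge>2. B n \<le> 2))"
    and "\<And>z. f z = z + (\<Sum>n. complex_of_real (A (n + 2)) * z ^ (n + 2))"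
  shows "(\<forall>z\<in>unit_disc. summable (\<lambda>n. complex_of_real (A (n + 2)) * z ^ (n + 2))) \<and>
         f \<in> class_K q \<and>
         q_close_to_convex_with q f (\<lambda>z. z / (1 - z))"
proof -
  note q = assms(1,2)
  define b where "b n = B (Suc n)" for n
  have b0: "b 0 = 1" using assms(3) assms(4)[of 1] q by (simp add: b_def)
  have monotone: "(\<forall>n. b (Suc n) \<le> b n) \<or> (\<forall>n. b n \<le> b (Suc n))"
    using assms(5)
  proof (elim disjE conjE)
    assume "1 \<ge> B 2" "\<forall>n\<ge>2. B n \<ge> B (Suc n)"
    then have "b (Suc n) \<le> b n" for n
      using b0 by (cases n) (auto simp: b_def numeral_2_eq_2)
    then show ?thesis by blast
  next
    assume "1 \<le> B 2" "\<forall>n\<ge>2. B n \<le> B (Suc n)"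
    then have "b n \<le> b (Suc n)" for n
      using b0 by (cases n) (auto simp: b_def numeral_2_eq_2)
    then show ?thesis by blast
  qed
  have near1: "\<bar>b n - 1\<bar> \<le> 1" for n
  proof -
    have "b n \<le> 1 \<and> 0 \<le> b n \<or> 1 \<le> b n \<and> b n \<le> 2"
    proof (cases "n = 0")
      case False
      then have n: "Suc n \<ge> 2" by simp
      from assms(5) show ?thesis
      proof (elim disjE conjE)
        assume *: "1 \<ge> B 2" "\<forall>n\<ge>2. B n \<ge> B (Suc n)" "\<forall>n\<ge>2. B n \<ge> 0"
        have "B (Suc n) \<le> B 2"
          using n by (induction rule: dec_induct) (use *(2) in \<open>auto intro: order_trans\<close>)
        then show ?thesis using * n by (auto simp: b_def)
      next
        assume *: "1 \<le> B 2" "\<forall>n\<ge>2. B n \<le> B (Suc n)" "\<forall>n\<ge>2. B n \<le> 2"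
        have "B 2 \<le> B (Suc n)"
          using n by (induction rule: dec_induct) (use *(2) in \<open>auto intro: order_trans\<close>)
        then show ?thesis using * n by (auto simp: b_def)
      qed
    qed (use b0 in auto)
    then show ?thesis by auto
  qed

  define c where "c n = complex_of_real (if n = 0 then 0 else A n)" for n
  have c_b: "c (Suc n) * of_real ((1 - q ^ Suc n) / (1 - q)) = of_real (b n)" for n
  proof -
    have "A (Suc n) * ((1 - q ^ Suc n) / (1 - q)) = b n"
      using assms(4)[of "Suc n"] by (simp add: b_def)
    then show ?thesis
      by (simp only: c_def nat.simps if_False flip: of_real_mult)
  qed
  have c_bound: "norm (c n) \<le> 2" for n
  proof (cases n)
    case (Suc m)
    \<comment> \<open>Since \<open>q ^ n \<le> q\<close> for \<open>n \<ge> 1\<close>, the factor taking \<open>A n\<close> to \<open>B n\<close> is at least \<open>1\<close>.\<close>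
    have "q ^ Suc m \<le> q" using q power_decreasing[of 1 "Suc m" q] by simp
    then have "1 \<le> (1 - q ^ Suc m) / (1 - q)" using q by (simp add: field_simps)
    then have "1 \<le> \<bar>(1 - q ^ Suc m) / (1 - q)\<bar>" by linarith
    then have "norm (c n) * 1 \<le> norm (c n) * \<bar>(1 - q ^ Suc m) / (1 - q)\<bar>"
      by (rule mult_left_mono) (rule norm_ge_zero)
    also have "\<dots> = \<bar>b m\<bar>"
      using arg_cong[OF c_b[of m], of norm] unfolding Suc norm_mult norm_of_real .
    also have "\<dots> \<le> 2" using near1[of m] by auto
    finally show ?thesis by simp
  qed (simp add: c_def)
  have summable: "summable (\<lambda>n. c n * z ^ n)" if "norm z < 1" for z
    using c_bound that by (rule summable_powser_bounded_coeffs)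
  have shift: "complex_of_real (A (n + 2)) * z ^ (n + 2) = c (n + 2) * z ^ (n + 2)" for n z
    by (simp add: c_def)
  have f: "f z = (\<Sum>n. c n * z ^ n)" if "norm z < 1" for z
    using suminf_split_initial_segment[OF summable[OF that], of 2] assms(3)
    by (simp add: assms(6) shift numeral_2_eq_2 c_def)
  have "c 0 = 0" "c 1 = 1" using assms(3) by (simp_all add: c_def)
  then have class_A: "f \<in> class_A"
    using powser_in_class_A[OF summable f] by blast

  have radius: "1 \<le> 1 / (1 - q)" using q by simp
  have bound: "cmod ((if z = 0 then 1 else z / (z / (1 - z))) * q_diff q f z
      - complex_of_real (1 / (1 - q))) \<le> 1 / (1 - q)" if z: "z \<in> unit_disc" for z
  proof (cases "z = 0")
    case True
    have "deriv f 0 = 1" using class_A by (simp add: class_A_def)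
    then have "(if z = 0 then 1 else z / (z / (1 - z))) * q_diff q f z
        - complex_of_real (1 / (1 - q)) = of_real (1 - 1 / (1 - q))"
      using True by (simp add: q_diff_def)
    then show ?thesis using radius by (simp only: norm_of_real)
  next
    case False
    have z1: "norm z < 1" using z by simp
    have "(\<lambda>n. of_real (b n) * z ^ n) sums q_diff q f z"
      using q_diff_powser[OF q summable f z1 False] by (simp only: c_b)
    then have "(\<lambda>n. (of_real (b (Suc n)) - of_real (b n)) * z ^ Suc n)
        sums ((1 - z) * q_diff q f z - of_real (b 0))"
      by (rule one_minus_times_powser)
    then have "norm ((1 - z) * q_diff q f z - of_real (b 0)) \<le> 1"
    proof (rule norm_powser_le_of_sum_norm_le[OF _ z1])
      show "(\<Sum>n<N. norm (complex_of_real (b (Suc n)) - of_real (b n))) \<le> 1" for N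
        using sum_abs_diff_monotone[OF monotone, of N] near1[of N] b0
        by (simp flip: of_real_diff)
    qed
    then have "norm (((1 - z) * q_diff q f z - 1) + of_real (1 - 1 / (1 - q)))
        \<le> 1 + \<bar>1 - 1 / (1 - q)\<bar>"
      using b0 by (intro norm_triangle_mono) (auto simp only: norm_of_real of_real_1)
    also have "\<dots> = 1 / (1 - q)"
      using radius by linarith
    finally have "norm ((1 - z) * q_diff q f z - of_real (1 / (1 - q))) \<le> 1 / (1 - q)"
      by simp
    moreover have "z / (z / (1 - z)) = 1 - z" using False by simp
    ultimately show ?thesis using False by simp
  qed
  have with_g: "q_close_to_convex_with q f (\<lambda>z. z / (1 - z))"
    using class_A half_plane_map_in_class_S_star bound
    unfolding q_close_to_convex_with_def by blast
  have "summable (\<lambda>n. complex_of_real (A (n + 2)) * z ^ (n + 2))" if "z \<in> unit_disc" for z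
    unfolding shift using summable[of z] that by (intro summable_ignore_initial_segment) simp
  with with_g show ?thesis by (auto simp: class_K_def)
qed

end
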